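(* Consider the setting with $n$ decision makers described in the context. Suppose: (H1) $\mathcal{E}_t=\boldsymbol{\mathcal{E}}$ for all rounds $t$, for a fixed matrix $\boldsymbol{\mathcal{E}}\in\mathbb{R}^{m\times d}$; (H2) for each decision maker $i$ and all rounds $t$, $\gamma_{it}=\gamma_i$ for some constant $\gamma_i\ge0$, and $Z_t$ is conditionally independent of $\{X_t,B_t\}$ given $\{W_{jt}\}_{j=1}^n$, with the same conditional law of $Z_t$ given $\{W_{jt}\}_{j=1}^n$ in all rounds. Suppose that all $n$ decision makers follow the cooperative protocol in two rounds $t$ and $t'$, i.e. in both rounds every decision maker $j\in\{1,\dots,n\}$ uses the ranking selection rule and $\boldsymbol{\theta}_{jt}=k_j\boldsymbol{\theta}_{jt'}$ for some $k_j>0$. Then, for every decision maker $i$, $$\mathbb{E}[Y_{it}\mid Z_t=i;\boldsymbol{\theta}^{\mathrm{all}}_t]-\mathbb{E}[Y_{it'}\mid Z_{t'}=i;\boldsymbol{\theta}^{\mathrm{all}}_{t'}]=\big(\mathbb{E}[X_t\mid Z_t=i;\boldsymbol{\theta}^{\mathrm{all}}_t]-\mathbb{E}[X_{t'}\mid Z_{t'}=i;\boldsymbol{\theta}^{\mathrm{all}}_{t'}]\big)^\top\boldsymbol{\theta}^*_i.$$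
   Context: Setting with $n\ge1$ decision makers (DMs). In each round $t$ each DM $i$ publishes a parameter vector $\boldsymbol{\theta}_{it}\in\mathbb{R}^m$ and a selection rule $\boldsymbol{\delta}_{\boldsymbol{\theta}_{it}}:\mathbb{R}^m\to[0,1]$; $\boldsymbol{\theta}_t^{\mathrm{all}}=\{\boldsymbol{\theta}_{jt}\}_{j=1}^n$. An agent arrives with random baseline $B_t\in\mathbb{R}^m$, effort conversion matrix $\mathcal{E}_t\in\mathbb{R}^{m\times d}$ and real-valued noises $O_{1t},\dots,O_{nt}$ (possibly correlated with $B_t$); the joint law of $(B_t,O_{1t},\dots,O_{nt})$ is the same in every round, with finite expectations, and does not depend on the published parameters. If the agent takes action $\mathbf{a}\in\mathbb{R}^d$, its covariates are $X_t=B_t+\mathcal{E}_t\mathbf{a}$ and its predicted outcomes are $\hat y_{it}=X_t^\top\boldsymbol{\theta}_{it}$. The agent chooses the action maximising $\sum_{i=1}^n\gamma_{it}\hat y_{it}-\frac12\|\mathbf{a}\|_2^2$ (with $\gamma_{it}\ge0$), i.e. $\mathbf{a}_t=\mathcal{E}_t^\top\sum_{i=1}^n\gamma_{it}\boldsymbol{\theta}_{it}$. Conditionally on $X_t$, the selection statuses $W_{1t},\dots,W_{nt}\in\{0,1\}$ are mutually independent, independent of $(B_t,O_{1t},\dots,O_{nt})$, with $W_{it}\sim\mathrm{Bernoulli}(\boldsymbol{\delta}_{\boldsymbol{\theta}_{it}}(X_t))$. The compliance variable $Z_t\in\{0,1,\dots,n\}$ indicates the DM whose positive decision the agent complies with ($0$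 if none); it is generated from $\{W_{jt}\}_{j=1}^n$ only (conditionally on $\{W_{jt}\}_j$ it is independent of all other variables). The potential outcome with DM $i$ is $Y_{it}=X_t^\top\boldsymbol{\theta}_i^*+O_{it}$, with $\boldsymbol{\theta}_i^*\in\mathbb{R}^m$ fixed. The notation "$;\boldsymbol{\theta}_t^{\mathrm{all}}$" indicates the distribution induced by deploying $\boldsymbol{\theta}_t^{\mathrm{all}}$. The events $\{Z_t=i\}$, $\{Z_{t'}=i\}$ conditioned on are assumed to have positive probability. Ranking selection rule for DM $j$: $\boldsymbol{\delta}_{\boldsymbol{\theta}_{jt}}(\mathbf{x})=p\big(X_t^\top\boldsymbol{\theta}_{jt}\le\mathbf{x}^\top\boldsymbol{\theta}_{jt}\big)$, the cumulative distribution function of $X_t^\top\boldsymbol{\theta}_{jt}$ (under deployment of $\boldsymbol{\theta}_t^{\mathrm{all}}$) evaluated at $\mathbf{x}^\top\boldsymbol{\theta}_{jt}$. *)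

theory Defs
  imports "HOL-Probability.Probability"
begin

section \<open>Conditioning\<close>

text \<open>
  Conditioning on a random variable \<open>V\<close> means conditioning on the sigma-algebra
  \<open>generated_by M N V\<close>. All statements below about conditional probabilities are
  almost sure statements about the library's \<open>real_cond_exp\<close>.
\<close>

definition generated_by :: "'w measure \<Rightarrow> 'v measure \<Rightarrow> ('w \<Rightarrow> 'v) \<Rightarrow> 'w measure" where
  "generated_by M N V = vimage_algebra (space M) V N"

definition cond_probability :: "'w measure \<Rightarrow> 'w measure \<Rightarrow> 'w set \<Rightarrow> 'w \<Rightarrow> real" where
  "cond_probability M F A = real_cond_exp M F (indicator A)"

text \<open>
  Conditional (mutual) independence follows the pattern of the library's
  \<open>prob_space.indep_vars\<close>, with probabilities replaced by conditional probabilities.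
\<close>

definition cond_indep_vars ::
  "'w measure \<Rightarrow> 'w measure \<Rightarrow> ('i \<Rightarrow> 'v measure) \<Rightarrow> ('i \<Rightarrow> 'w \<Rightarrow> 'v) \<Rightarrow> 'i set \<Rightarrow> bool" where
  "cond_indep_vars M F N V I \<longleftrightarrow>
     (\<forall>i\<in>I. V i \<in> measurable M (N i)) \<and>
     (\<forall>J\<subseteq>I. J \<noteq> {} \<longrightarrow> finite J \<longrightarrow> (\<forall>A\<in>Pi J (\<lambda>j. sets (N j)).
        AE \<omega> in M. cond_probability M F (\<Inter>j\<in>J. V j -` A j \<inter> space M) \<omega>
                 = (\<Prod>j\<in>J. cond_probability M F (V j -` A j \<inter> space M) \<omega>)))"

definition cond_indep_var ::
  "'w measure \<Rightarrow> 'w measure \<Rightarrow> 'u measure \<Rightarrow> ('w \<Rightarrow> 'u) \<Rightarrow> 'v measure \<Rightarrow> ('w \<Rightarrow> 'v) \<Rightarrow> bool" where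
  "cond_indep_var M F S U T V \<longleftrightarrow>
     U \<in> measurable M S \<and> V \<in> measurable M T \<and>
     (\<forall>A\<in>sets S. \<forall>C\<in>sets T.
        AE \<omega> in M. cond_probability M F ((U -` A \<inter> space M) \<inter> (V -` C \<inter> space M)) \<omega>
                 = cond_probability M F (U -` A \<inter> space M) \<omega>
                 * cond_probability M F (V -` C \<inter> space M) \<omega>)"

text \<open>
  \<open>has_cond_law M F U K\<close>: the conditional law, given \<open>F\<close>, of the discrete random
  variable \<open>U\<close> is the random distribution \<open>K \<omega>\<close>.
\<close>

definition has_cond_law ::
  "'w measure \<Rightarrow> 'w measure \<Rightarrow> ('w \<Rightarrow> 'u::countable) \<Rightarrow> ('w \<Rightarrow> 'u pmf) \<Rightarrow> bool" where
  "has_cond_law M F U K \<longleftrightarrow>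
     U \<in> measurable M (count_space UNIV) \<and>
     (\<forall>u. AE \<omega> in M. cond_probability M F {\<omega>'\<in>space M. U \<omega>' = u} \<omega> = pmf (K \<omega>) u)"

text \<open>
  Elementary conditional expectation given an event of positive probability, i.e. the
  expectation under the measure \<open>A \<mapsto> P (A \<inter> E) / P E\<close>.
\<close>

definition event_expectation ::
  "'w measure \<Rightarrow> 'w set \<Rightarrow> ('w \<Rightarrow> 'v::{banach, second_countable_topology}) \<Rightarrow> 'v" where
  "event_expectation M E f = (\<integral>\<omega>. f \<omega> \<partial>uniform_measure M E)"


section \<open>Agents and decision makers\<close>

text \<open>
  Decision makers are indexed by the finite type \<open>'n\<close>, parameters and covariates live in
  \<open>real ^ 'm\<close>, actions in \<open>real ^ 'd\<close>; \<open>real ^ 'd ^ 'm\<close> is the type of matrices with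
  \<open>m\<close> rows and \<open>d\<close> columns. Selection statuses are booleans (\<open>True\<close> for \<open>1\<close>), and the
  compliance variable has values in \<open>'n option\<close>, with \<open>None\<close> for \<open>0\<close> (no compliance).
\<close>

definition covariates :: "real ^ 'm \<Rightarrow> real ^ 'd ^ 'm \<Rightarrow> real ^ 'd \<Rightarrow> real ^ 'm" where
  "covariates b E a = b + E *v a"

definition agent_payoff ::
  "('n::finite \<Rightarrow> real) \<Rightarrow> ('n \<Rightarrow> real ^ 'm) \<Rightarrow> real ^ 'm \<Rightarrow> real ^ 'd ^ 'm \<Rightarrow> real ^ 'd \<Rightarrow> real" where
  "agent_payoff \<gamma> \<theta> b E a = (\<Sum>i\<in>UNIV. \<gamma> i * (covariates b E a \<bullet> \<theta> i)) - 1/2 * (norm a)\<^sup>2"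

text \<open>
  \<open>M\<close> is the probability space of the round and \<open>X\<close> the covariates of the arriving
  agent, under deployment of all published parameters.
\<close>

definition ranking_rule ::
  "'w measure \<Rightarrow> ('w \<Rightarrow> real ^ 'm) \<Rightarrow> real ^ 'm \<Rightarrow> real ^ 'm \<Rightarrow> real" where
  "ranking_rule M X \<theta> x = \<P>(\<omega> in M. X \<omega> \<bullet> \<theta> \<le> x \<bullet> \<theta>)"

text \<open>
  Rounds are natural numbers; \<open>M t\<close> and \<open>X t\<close> are the probability space and the
  covariates of round \<open>t\<close>, and \<open>\<theta> t j\<close>, \<open>\<delta> t j\<close> the parameter vector and selection rule
  published by decision maker \<open>j\<close> in that round.
\<close>

definition cooperative_protocol ::
  "(nat \<Rightarrow> 'w measure) \<Rightarrow> (nat \<Rightarrow> 'w \<Rightarrow> real ^ 'm) \<Rightarrow> (nat \<Rightarrow> 'n::finite \<Rightarrow> real ^ 'm) \<Rightarrow>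
   (nat \<Rightarrow> 'n \<Rightarrow> real ^ 'm \<Rightarrow> real) \<Rightarrow> nat \<Rightarrow> nat \<Rightarrow> bool" where
  "cooperative_protocol M X \<theta> \<delta> t t' \<longleftrightarrow>
     (\<forall>j. \<delta> t j = ranking_rule (M t) (X t) (\<theta> t j) \<and>
          \<delta> t' j = ranking_rule (M t') (X t') (\<theta> t' j) \<and>
          (\<exists>k>0. \<theta> t j = k *\<^sub>R \<theta> t' j))"

end

theory Submission
  imports Defs
begin

text \<open>
  The best response shifts the baseline by a constant of the round, so under a ranking rule the
  selection probability of an agent is the cumulative distribution function of
  \<open>B \<bullet> \<theta>\<close> at its own baseline. This does not change when \<open>\<theta>\<close> is rescaled by a positive factor,
  hence each agent is selected with the same probability in both rounds. The law of \<open>(B, O)\<close>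
  restricted to \<open>Z = i\<close> therefore has the same density with respect to the common law of \<open>(B, O)\<close>
  in both rounds, and the conditional expectations of the noise cancel.
\<close>

lemma subalgebra_generated_by:
  assumes "V \<in> measurable M N"
  shows "subalgebra M (generated_by M N V)"
  using assms unfolding subalgebra_def generated_by_def
  by (auto simp: sets_vimage_algebra2[OF measurable_space[OF assms, THEN Pi_I]] intro: measurable_sets)

lemma cond_indep_var_compose:
  assumes "cond_indep_var M F S U T V" and f: "f \<in> measurable T T'"
  shows "cond_indep_var M F S U T' (\<lambda>\<omega>. f (V \<omega>))"
proof -
  have V: "V \<in> measurable M T" using assms(1) by (simp add: cond_indep_var_def)
  have pre: "(\<lambda>\<omega>. f (V \<omega>)) -` C \<inter> space M = V -` (f -` C \<inter> space T) \<inter> space M" for C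
    using measurable_space[OF V] by auto
  show ?thesis
    using assms(1) measurable_compose[OF V f] measurable_sets[OF f]
    unfolding cond_indep_var_def pre by blast
qed

text \<open>Integrating the product formula for the conditional probabilities and then moving the
  conditional expectation off the second factor leaves the conditional probability of the first
  event integrated over the second event itself. Any measurable version \<open>p\<close> is allowed,
  so that explicit formulas can be inserted later.\<close>

lemma cond_indep_var_measure:
  assumes "prob_space M" and F: "subalgebra M F"
    and indep: "cond_indep_var M F S U T V"
    and A: "A \<in> sets S" and C: "C \<in> sets T"
    and p: "AE \<omega> in M. cond_probability M F (U -` A \<inter> space M) \<omega> = p \<omega>"
      "p \<in> borel_measurable M"
  shows "measure M ((U -` A \<inter> space M) \<inter> (V -` C \<inter> space M))
       = (\<integral>\<omega>. p \<omega> * indicator (V -` C \<inter> space M) \<omega> \<partial>M)"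
    and "integrable M (\<lambda>\<omega>. p \<omega> * indicator (V -` C \<inter> space M) \<omega>)"
proof -
  interpret prob_space M by fact
  interpret finite_measure_subalgebra M F by unfold_locales (rule F)
  let ?A = "U -` A \<inter> space M" and ?C = "V -` C \<inter> space M"
  have [measurable]: "?A \<in> sets M" "?C \<in> sets M"
    using indep A C by (auto simp: cond_indep_var_def intro: measurable_sets)
  note [measurable] = p(2)
  have int: "integrable M (indicator D :: _ \<Rightarrow> real)" if "D \<in> sets M" for D
    using that by (simp add: integrable_indicator_iff emeasure_eq_measure)
  have AC: "?A \<inter> ?C \<in> sets M" by measurable
  \<comment> \<open>The version \<open>p\<close> inherits the bounds of a conditional probability
    only almost surely. This is enough to make the integrand bounded, hence integrable.\<close>
  have p01: "AE \<omega> in M. 0 \<le> p \<omega> \<and> p \<omega> \<le> 1"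
  proof -
    have "AE \<omega> in M. real_cond_exp M F (indicator ?A) \<omega> \<ge> 0"
      by (rule real_cond_exp_ge_c) (auto intro: int)
    moreover have "AE \<omega> in M. real_cond_exp M F (indicator ?A) \<omega> \<le> 1"
      by (rule real_cond_exp_le_c) (auto intro: int simp: indicator_def)
    ultimately show ?thesis using p(1) unfolding cond_probability_def by eventually_elim auto
  qed
  show i: "integrable M (\<lambda>\<omega>. p \<omega> * indicator ?C \<omega>)"
  proof (rule integrable_const_bound[where B=1])
    show "AE \<omega> in M. norm (p \<omega> * indicator ?C \<omega>) \<le> 1"
      using p01 by eventually_elim (auto simp: indicator_def)
    show "(\<lambda>\<omega>. p \<omega> * indicator ?C \<omega>) \<in> borel_measurable M"
      using p(2) \<open>?C \<in> sets M\<close> by (intro borel_measurable_times borel_measurable_indicator)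
  qed
  have i': "integrable M (\<lambda>\<omega>. real_cond_exp M F (indicator ?A) \<omega> * indicator ?C \<omega>)"
    by (rule Bochner_Integration.integrable_cong_AE_imp[OF i])
      (use p(1) in \<open>auto simp: cond_probability_def elim: eventually_mono\<close>)
  have "measure M (?A \<inter> ?C) = (\<integral>\<omega>. indicator (?A \<inter> ?C) \<omega> \<partial>M)"
    using sets.sets_into_space[OF AC] by (simp add: Int_absorb2)
  also have "\<dots> = (\<integral>\<omega>. real_cond_exp M F (indicator (?A \<inter> ?C)) \<omega> \<partial>M)"
    by (rule real_cond_exp_int(2)[symmetric]) (rule int[OF AC])
  also have "\<dots> = (\<integral>\<omega>. real_cond_exp M F (indicator ?A) \<omega> * real_cond_exp M F (indicator ?C) \<omega> \<partial>M)"
    using indep A C unfolding cond_indep_var_def cond_probability_def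
    by (intro integral_cong_AE) auto
  \<comment> \<open>The first factor is measurable with respect to \<open>F\<close>, so under the
    integral the conditional expectation of \<open>indicator ?C\<close> can be replaced by
    \<open>indicator ?C\<close>.\<close>
  also have "\<dots> = (\<integral>\<omega>. real_cond_exp M F (indicator ?A) \<omega> * indicator ?C \<omega> \<partial>M)"
    by (rule real_cond_exp_intg(2)[OF i']) auto
  also have "\<dots> = (\<integral>\<omega>. p \<omega> * indicator ?C \<omega> \<partial>M)"
    using p(1) by (intro integral_cong_AE) (auto simp: cond_probability_def elim: eventually_mono)
  finally show "measure M (?A \<inter> ?C) = (\<integral>\<omega>. p \<omega> * indicator ?C \<omega> \<partial>M)" .
qed

lemma measurable_pmf_bernoulli:
  assumes "p \<in> borel_measurable N" and "\<And>x. 0 \<le> p x \<and> p x \<le> 1"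
  shows "(\<lambda>x. pmf (bernoulli_pmf (p x)) b) \<in> borel_measurable N"
proof -
  have "pmf (bernoulli_pmf (p x)) b = (if b then p x else 1 - p x)" for x
    using assms(2)[of x] by (cases b) auto
  then show ?thesis using assms(1) by simp
qed

text \<open>Two conditionings in succession: given the statuses, \<open>Z\<close> follows
  \<open>\<kappa>\<close> independently of \<open>V\<close>; given the covariates, the statuses are
  a product of Bernoulli variables independent of \<open>V\<close>. The finitely many status
  patterns \<open>w\<close> are summed over. The factor in front of the indicator is thus a function
  of the covariates alone.\<close>

lemma selected_joint_law:
  fixes W :: "'n::finite \<Rightarrow> 'w \<Rightarrow> bool" and Z :: "'w \<Rightarrow> 'z::countable"
  assumes P: "prob_space M" and X: "X \<in> borel_measurable M"
    and \<delta>: "\<And>j x. 0 \<le> \<delta> j x \<and> \<delta> j x \<le> 1" "\<And>j. \<delta> j \<in> borel_measurable borel"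
    and W_law: "\<And>j. has_cond_law M (generated_by M borel X) (W j)
          (\<lambda>\<omega>. bernoulli_pmf (\<delta> j (X \<omega>)))"
    and W_indep: "cond_indep_vars M (generated_by M borel X) (\<lambda>_. count_space UNIV) W UNIV"
    and W_indep_V: "cond_indep_var M (generated_by M borel X)
          (count_space UNIV) (\<lambda>\<omega> j. W j \<omega>) N V"
    and Z_indep: "cond_indep_var M (generated_by M (count_space UNIV) (\<lambda>\<omega> j. W j \<omega>))
          (count_space UNIV) Z N V"
    and Z_law: "has_cond_law M (generated_by M (count_space UNIV) (\<lambda>\<omega> j. W j \<omega>)) Z
          (\<lambda>\<omega>. \<kappa> (\<lambda>j. W j \<omega>))"
    and C: "C \<in> sets N"
  shows "measure M ({\<omega>\<in>space M. Z \<omega> = z} \<inter> (V -` C \<inter> space M))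
    = (\<integral>\<omega>. (\<Sum>w\<in>UNIV. pmf (\<kappa> w) z * (\<Prod>j\<in>UNIV. pmf (bernoulli_pmf (\<delta> j (X \<omega>))) (w j)))
            * indicator (V -` C \<inter> space M) \<omega> \<partial>M)"
proof -
  interpret prob_space M by fact
  let ?FX = "generated_by M borel X" and ?FW = "generated_by M (count_space UNIV) (\<lambda>\<omega> j. W j \<omega>)"
  let ?C = "V -` C \<inter> space M"
  let ?q = "\<lambda>w \<omega>. \<Prod>j\<in>UNIV. pmf (bernoulli_pmf (\<delta> j (X \<omega>))) (w j)"
  let ?A = "\<lambda>w. (\<lambda>\<omega> j. W j \<omega>) -` {w} \<inter> space M"
  have Wm[measurable]: "(\<lambda>\<omega> j. W j \<omega>) \<in> measurable M (count_space UNIV)"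
    and Cm[measurable]: "?C \<in> sets M"
    using W_indep_V C by (auto simp: cond_indep_var_def intro: measurable_sets)
  have Am[measurable]: "?A w \<in> sets M" for w
    using Wm by (rule measurable_sets) simp
  have sFX: "subalgebra M ?FX" and sFW: "subalgebra M ?FW"
    using X Wm by (auto intro: subalgebra_generated_by)
  have qm[measurable]: "?q w \<in> borel_measurable M" for w
    using \<delta> by (intro borel_measurable_prod measurable_pmf_bernoulli)
      (auto intro: measurable_compose[OF X])
  \<comment> \<open>There are finitely many decision makers, so fixing the whole pattern is a finite
    intersection of single-status events, and mutual conditional independence turns its probability
    into a product.\<close>
  have q: "AE \<omega> in M. cond_probability M ?FX (?A w) \<omega> = ?q w \<omega>" for w
  proof -
    have "?A w = (\<Inter>j\<in>UNIV. W j -` {w j} \<inter> space M)" by auto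
    moreover have "AE \<omega> in M. cond_probability M ?FX (\<Inter>j\<in>UNIV. W j -` {w j} \<inter> space M) \<omega>
        = (\<Prod>j\<in>UNIV. cond_probability M ?FX (W j -` {w j} \<inter> space M) \<omega>)"
      using W_indep unfolding cond_indep_vars_def by auto
    moreover have "AE \<omega> in M. \<forall>j. cond_probability M ?FX (W j -` {w j} \<inter> space M) \<omega>
        = pmf (bernoulli_pmf (\<delta> j (X \<omega>))) (w j)"
    proof (subst AE_all_countable, intro allI)
      fix j
      have "W j -` {w j} \<inter> space M = {\<omega>'\<in>space M. W j \<omega>' = w j}" by auto
      then show "AE \<omega> in M. cond_probability M ?FX (W j -` {w j} \<inter> space M) \<omega>
          = pmf (bernoulli_pmf (\<delta> j (X \<omega>))) (w j)"
        using W_law[of j] unfolding has_cond_law_def by simp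
    qed
    ultimately show ?thesis by (auto elim!: eventually_elim2)
  qed
  have W_joint: "measure M (?A w \<inter> ?C) = (\<integral>\<omega>. ?q w \<omega> * indicator ?C \<omega> \<partial>M)"
    and q_int: "integrable M (\<lambda>\<omega>. ?q w \<omega> * indicator ?C \<omega>)" for w
    using cond_indep_var_measure[OF P sFX W_indep_V _ C q qm] by auto
  \<comment> \<open>For each outcome only the pattern that actually occurs contributes to the sum.
    This makes the random law of \<open>Z\<close> a finite combination of indicators with constant
    weights.\<close>
  have split: "pmf (\<kappa> (\<lambda>j. W j \<omega>)) z * indicator ?C \<omega>
      = (\<Sum>w\<in>UNIV. pmf (\<kappa> w) z * indicator (?A w \<inter> ?C) \<omega>)" if "\<omega> \<in> space M" for \<omega>
  proof -
    have "(\<Sum>w\<in>UNIV. pmf (\<kappa> w) z * indicator (?A w \<inter> ?C) \<omega>)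
        = (\<Sum>w\<in>UNIV. if w = (\<lambda>j. W j \<omega>) then pmf (\<kappa> w) z * indicator ?C \<omega> else 0)"
      using that by (intro sum.cong) (auto simp: indicator_def)
    then show ?thesis by simp
  qed
  have Zset: "{\<omega>\<in>space M. Z \<omega> = u} = Z -` {u} \<inter> space M" for u by auto
  \<comment> \<open>First conditioning, on the statuses, with the version of the conditional
    probability supplied by \<open>\<kappa>\<close>.\<close>
  have "measure M ((Z -` {z} \<inter> space M) \<inter> ?C)
      = (\<integral>\<omega>. pmf (\<kappa> (\<lambda>j. W j \<omega>)) z * indicator ?C \<omega> \<partial>M)"
    using Z_law unfolding has_cond_law_def Zset
    by (intro cond_indep_var_measure(1)[OF P sFW Z_indep _ C]
          measurable_compose[OF Wm]) auto
  also have "\<dots> = (\<integral>\<omega>. (\<Sum>w\<in>UNIV. pmf (\<kappa> w) z * indicator (?A w \<inter> ?C) \<omega>) \<partial>M)"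
    by (rule Bochner_Integration.integral_cong[OF refl split])
  also have "\<dots> = (\<Sum>w\<in>UNIV. pmf (\<kappa> w) z * measure M (?A w \<inter> ?C))"
  proof -
    have "integrable M (\<lambda>\<omega>. indicator (?A w \<inter> ?C) \<omega> :: real)" for w
      using sets.Int[OF Am Cm] by (simp add: integrable_indicator_iff emeasure_eq_measure)
    moreover have "(\<integral>\<omega>. indicator (?A w \<inter> ?C) \<omega> \<partial>M) = measure M (?A w \<inter> ?C)" for w
      by (simp add: Int_assoc)
    ultimately show ?thesis
      by (subst Bochner_Integration.integral_sum) auto
  qed
  \<comment> \<open>Second conditioning, on the covariates, applied to each pattern
    separately.\<close>
  also have "\<dots> = (\<integral>\<omega>. (\<Sum>w\<in>UNIV. pmf (\<kappa> w) z * (?q w \<omega> * indicator ?C \<omega>)) \<partial>M)"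
    unfolding W_joint by (subst Bochner_Integration.integral_sum) (auto intro: q_int)
  finally show ?thesis
    unfolding Zset by (simp add: sum_distrib_right mult.assoc)
qed

text \<open>Completing the square: the payoff is a constant minus half the squared distance from
  \<open>?u\<close>, so \<open>?u\<close> is the only maximiser. It does not involve the baseline
  \<open>b\<close>, which is why all agents of a round are shifted alike.\<close>

lemma payoff_maximiser:
  fixes \<theta> :: "'n::finite \<Rightarrow> real ^ 'm" and E :: "real ^ 'd ^ 'm"
  assumes "is_arg_max (agent_payoff \<gamma> \<theta> b E) (\<lambda>_. True) a"
  shows "a = transpose E *v (\<Sum>i\<in>UNIV. \<gamma> i *\<^sub>R \<theta> i)"
proof -
  let ?v = "\<Sum>i\<in>UNIV. \<gamma> i *\<^sub>R \<theta> i"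
  let ?u = "transpose E *v ?v"
  have payoff: "agent_payoff \<gamma> \<theta> b E x = b \<bullet> ?v + 1/2 * (norm ?u)\<^sup>2 - 1/2 * (norm (x - ?u))\<^sup>2" for x
  proof -
    have "(\<Sum>i\<in>UNIV. \<gamma> i * (covariates b E x \<bullet> \<theta> i)) = (b + E *v x) \<bullet> ?v"
      by (simp add: covariates_def inner_sum_right)
    also have "\<dots> = b \<bullet> ?v + x \<bullet> ?u"
      by (simp add: inner_add_left dot_lmul_matrix inner_commute flip: vector_transpose_matrix)
    finally show ?thesis
      unfolding agent_payoff_def
      by (simp add: power2_norm_eq_inner algebra_simps inner_commute)
  qed
  have "\<not> agent_payoff \<gamma> \<theta> b E ?u > agent_payoff \<gamma> \<theta> b E a"
    using assms unfolding is_arg_max_def by blast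
  then show ?thesis unfolding payoff by simp
qed

text \<open>The conditioned measure has the density \<open>indicator A x / measure M A\<close>,
  which is bounded, so integrability carries over from \<open>M\<close>.\<close>

lemma integrable_uniform_measure:
  fixes f :: "'a \<Rightarrow> 'b::{banach, second_countable_topology}"
  assumes f: "integrable M f" and A: "A \<in> sets M" "0 < measure M A"
  shows "integrable (uniform_measure M A) f"
proof -
  \<comment> \<open>\<open>measure\<close> takes the default value 0 on sets of infinite
    \<open>emeasure\<close>, so positivity already forces finiteness.\<close>
  have "emeasure M A = ennreal (measure M A)"
    using A(2) by (intro emeasure_eq_ennreal_measure) (auto simp: measure_def)
  then have "uniform_measure M A = density M (\<lambda>x. ennreal (indicator A x / measure M A))"
    unfolding uniform_measure_def using A(2)
    by (intro arg_cong[where f="density M"] ext) (auto simp: indicator_def divide_ennreal simp flip: ennreal_1)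
  moreover have "integrable M (\<lambda>x. (indicator A x / measure M A) *\<^sub>R f x)"
    using integrable_scaleR_right[OF integrable_mult_indicator[OF A(1) f], of "1 / measure M A"]
    by (simp add: field_simps)
  ultimately show ?thesis using A f by (simp add: integrable_density)
qed

theorem theorem3p8:
  fixes M :: "nat \<Rightarrow> 'w measure"
    and \<theta> :: "nat \<Rightarrow> 'n::finite \<Rightarrow> real ^ 'm"
    and \<delta> :: "nat \<Rightarrow> 'n \<Rightarrow> real ^ 'm \<Rightarrow> real"
    and \<gamma> :: "nat \<Rightarrow> 'n \<Rightarrow> real"
    and \<E> :: "nat \<Rightarrow> real ^ 'd ^ 'm"
    and B :: "nat \<Rightarrow> 'w \<Rightarrow> real ^ 'm"
    and O\<^sub>n :: "nat \<Rightarrow> 'n \<Rightarrow> 'w \<Rightarrow> real"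
    and a :: "nat \<Rightarrow> 'w \<Rightarrow> real ^ 'd"
    and X :: "nat \<Rightarrow> 'w \<Rightarrow> real ^ 'm"
    and W :: "nat \<Rightarrow> 'n \<Rightarrow> 'w \<Rightarrow> bool"
    and Z :: "nat \<Rightarrow> 'w \<Rightarrow> 'n::finite option"
    and Y :: "nat \<Rightarrow> 'n \<Rightarrow> 'w \<Rightarrow> real"
    and \<theta>star :: "'n \<Rightarrow> real ^ 'm"
    and E\<^sub>0 :: "real ^ 'd ^ 'm"
    and \<gamma>\<^sub>0 :: "'n \<Rightarrow> real"
    and \<kappa> :: "('n \<Rightarrow> bool) \<Rightarrow> 'n option pmf"
    and t t' :: nat
    and i :: 'n
  assumes prob: "\<And>s. prob_space (M s)"
    and rule_range: "\<And>s j x. 0 \<le> \<delta> s j x \<and> \<delta> s j x \<le> 1"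
    and rule_measurable: "\<And>s j. \<delta> s j \<in> borel_measurable borel"
    and B_integrable: "\<And>s. integrable (M s) (B s)"
    and O_integrable: "\<And>s j. integrable (M s) (O\<^sub>n s j)"
    and same_law: "\<And>s s'. distr (M s) borel (\<lambda>\<omega>. (B s \<omega>, \<chi> j. O\<^sub>n s j \<omega>))
                        = distr (M s') borel (\<lambda>\<omega>. (B s' \<omega>, \<chi> j. O\<^sub>n s' j \<omega>))"
    and \<gamma>_nonneg: "\<And>s j. 0 \<le> \<gamma> s j"
    and best_response: "\<And>s \<omega>. \<omega> \<in> space (M s) \<Longrightarrow>
          is_arg_max (agent_payoff (\<gamma> s) (\<theta> s) (B s \<omega>) (\<E> s)) (\<lambda>_. True) (a s \<omega>)"
    and X_eq: "\<And>s \<omega>. \<omega> \<in> space (M s) \<Longrightarrow> X s \<omega> = covariates (B s \<omega>) (\<E> s) (a s \<omega>)"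
    and W_law: "\<And>s j. has_cond_law (M s) (generated_by (M s) borel (X s)) (W s j)
          (\<lambda>\<omega>. bernoulli_pmf (\<delta> s j (X s \<omega>)))"
    and W_indep: "\<And>s. cond_indep_vars (M s) (generated_by (M s) borel (X s))
          (\<lambda>_. count_space UNIV) (W s) UNIV"
    and W_indep_BO: "\<And>s. cond_indep_var (M s) (generated_by (M s) borel (X s))
          (count_space UNIV) (\<lambda>\<omega> j. W s j \<omega>)
          borel (\<lambda>\<omega>. (B s \<omega>, \<chi> j. O\<^sub>n s j \<omega>))"
    and Z_complies: "\<And>s. AE \<omega> in M s. \<forall>j. Z s \<omega> = Some j \<longrightarrow> W s j \<omega>"
    and Z_indep: "\<And>s. cond_indep_var (M s)
          (generated_by (M s) (count_space UNIV) (\<lambda>\<omega> j. W s j \<omega>))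
          (count_space UNIV) (Z s)
          borel (\<lambda>\<omega>. (X s \<omega>, B s \<omega>, \<chi> j. O\<^sub>n s j \<omega>))"
    and Y_eq: "\<And>s j \<omega>. \<omega> \<in> space (M s) \<Longrightarrow> Y s j \<omega> = X s \<omega> \<bullet> \<theta>star j + O\<^sub>n s j \<omega>"
    and H1: "\<And>s. \<E> s = E\<^sub>0"
    and H2_\<gamma>: "\<And>s j. \<gamma> s j = \<gamma>\<^sub>0 j" "\<And>j. 0 \<le> \<gamma>\<^sub>0 j"
    and H2_Z_indep: "\<And>s. cond_indep_var (M s)
          (generated_by (M s) (count_space UNIV) (\<lambda>\<omega> j. W s j \<omega>))
          (count_space UNIV) (Z s)
          borel (\<lambda>\<omega>. (X s \<omega>, B s \<omega>))"
    and H2_Z_law: "\<And>s. has_cond_law (M s)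
          (generated_by (M s) (count_space UNIV) (\<lambda>\<omega> j. W s j \<omega>)) (Z s)
          (\<lambda>\<omega>. \<kappa> (\<lambda>j. W s j \<omega>))"
    and cooperative: "cooperative_protocol M X \<theta> \<delta> t t'"
    and pos: "0 < \<P>(\<omega> in M t. Z t \<omega> = Some i)" "0 < \<P>(\<omega> in M t'. Z t' \<omega> = Some i)"
  shows "event_expectation (M t) {\<omega> \<in> space (M t). Z t \<omega> = Some i} (Y t i)
           - event_expectation (M t') {\<omega> \<in> space (M t'). Z t' \<omega> = Some i} (Y t' i)
       = (event_expectation (M t) {\<omega> \<in> space (M t). Z t \<omega> = Some i} (X t)
           - event_expectation (M t') {\<omega> \<in> space (M t'). Z t' \<omega> = Some i} (X t')) \<bullet> \<theta>star i"
proof -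
  \<comment> \<open>Baseline and noise are kept together because they may be correlated: selection
    through the baseline can also change the law of the noise.\<close>
  define V where "V s \<omega> = (B s \<omega>, \<chi> j. O\<^sub>n s j \<omega>)" for s \<omega>
  define E where "E s = {\<omega> \<in> space (M s). Z s \<omega> = Some i}" for s
  \<comment> \<open>The effect of the best response on the covariates; H1 and H2 make it
    deterministic within a round.\<close>
  define c where "c s = E\<^sub>0 *v (transpose E\<^sub>0 *v (\<Sum>j\<in>UNIV. \<gamma>\<^sub>0 j *\<^sub>R \<theta> s j))" for s
  \<comment> \<open>For rounds \<open>t\<close> and \<open>t'\<close> this will be the conditional
    probability of \<open>Z = Some i\<close> at baseline \<open>b\<close>. It is written with the
    rules and the shift of round \<open>t\<close> only; \<open>\<delta>_eq\<close> makes it valid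
    for round \<open>t'\<close> too.\<close>
  define g where "g b = (\<Sum>w\<in>UNIV. pmf (\<kappa> w) (Some i)
      * (\<Prod>j\<in>UNIV. pmf (bernoulli_pmf (\<delta> t j (b + c t))) (w j)))" for b
  have X: "X s \<omega> = B s \<omega> + c s" if "\<omega> \<in> space (M s)" for s \<omega>
    using X_eq[OF that] payoff_maximiser[OF best_response[OF that]]
    by (simp add: covariates_def c_def H1 H2_\<gamma>)
  have XV: "(\<lambda>\<omega>. (X s \<omega>, V s \<omega>)) \<in> borel_measurable (M s)" for s
    using Z_indep[of s] by (simp add: cond_indep_var_def V_def)
  have Vm[measurable]: "V s \<in> borel_measurable (M s)" for s
    using W_indep_BO[of s] by (simp add: cond_indep_var_def V_def[abs_def])
  have Xm: "X s \<in> borel_measurable (M s)" for s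
    using measurable_compose[OF XV, of fst borel s] by (simp add: borel_measurable_continuous_onI continuous_on_fst)
  have Em[measurable]: "E s \<in> sets (M s)" for s
  proof -
    have "Z s \<in> measurable (M s) (count_space UNIV)" using H2_Z_law[of s] by (simp add: has_cond_law_def)
    from measurable_sets[OF this, of "{Some i}"] show ?thesis
      by (auto simp: E_def vimage_def Int_def conj_commute)
  qed
  have law: "distr (M s) borel (V s) = distr (M t) borel (V t)" for s
    using same_law[of s t] by (simp add: V_def[abs_def])
  \<comment> \<open>The shift \<open>c s\<close> occurs on both sides of the ranking inequality and
    cancels. What remains is an event about the baseline, whose law is common to all rounds and can
    be taken from round \<open>t\<close>.\<close>
  have cdf: "ranking_rule (M s) (X s) v (b + c s)
      = measure (distr (M t) borel (V t)) {x. fst x \<bullet> v \<le> b \<bullet> v}" for s v b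
  proof -
    have "{x. fst x \<bullet> v \<le> b \<bullet> v} \<in> sets (borel :: ((real^'m) \<times> (real^'n)) measure)"
      by (intro borel_closed closed_Collect_le continuous_intros)
    moreover have "{\<omega>\<in>space (M s). X s \<omega> \<bullet> v \<le> (b + c s) \<bullet> v}
        = V s -` {x. fst x \<bullet> v \<le> b \<bullet> v} \<inter> space (M s)"
      by (auto simp: X V_def inner_add_left)
    ultimately show ?thesis
      unfolding ranking_rule_def law[of s, symmetric] by (simp add: measure_distr)
  qed
  \<comment> \<open>With the shifts gone, the two rules differ only in the factor \<open>k\<close>,
    and a positive factor does not change which baselines rank below \<open>b\<close>.\<close>
  have \<delta>_eq: "\<delta> t j (b + c t) = \<delta> t' j (b + c t')" for j b
  proof -
    obtain k where k: "k > 0" "\<theta> t j = k *\<^sub>R \<theta> t' j"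
      and r: "\<delta> t j = ranking_rule (M t) (X t) (\<theta> t j)" "\<delta> t' j = ranking_rule (M t') (X t') (\<theta> t' j)"
      using cooperative unfolding cooperative_protocol_def by blast
    show ?thesis using k(1) unfolding r cdf k(2) by simp
  qed
  have gm[measurable]: "(\<lambda>v. g (fst v)) \<in> borel_measurable (borel :: ((real^'m) \<times> (real^'n)) measure)"
  proof -
    have "(\<lambda>v. fst v + c t) \<in> borel_measurable (borel :: ((real^'m) \<times> (real^'n)) measure)"
      by (intro borel_measurable_continuous_onI continuous_intros)
    from measurable_compose[OF this rule_measurable] show ?thesis
      unfolding g_def using rule_range
      by (intro borel_measurable_sum borel_measurable_times borel_measurable_prod
          measurable_pmf_bernoulli) auto
  qed
  \<comment> \<open>The right-hand side does not mention \<open>s\<close>: restricted to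
    \<open>E s\<close>, the law of \<open>V s\<close> has density \<open>g\<close> of the baseline
    with respect to the common law.\<close>
  have joint: "measure (M s) (E s \<inter> (V s -` C \<inter> space (M s)))
      = (\<integral>v. g (fst v) * indicator C v \<partial>distr (M t) borel (V t))"
    if s: "s = t \<or> s = t'" and C: "C \<in> sets borel" for s C
  proof -
    \<comment> \<open>Compliance is independent of covariates, baseline and noise jointly;
      projecting away the covariates leaves \<open>V s\<close>.\<close>
    have Z: "cond_indep_var (M s) (generated_by (M s) (count_space UNIV) (\<lambda>\<omega> j. W s j \<omega>))
        (count_space UNIV) (Z s) borel (V s)"
      using cond_indep_var_compose[OF Z_indep[of s], of snd borel]
      by (simp add: V_def[abs_def] borel_measurable_continuous_onI continuous_on_snd)
    have "\<delta> s j (b + c s) = \<delta> t j (b + c t)" for j b using s \<delta>_eq by auto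
    then have "measure (M s) (E s \<inter> (V s -` C \<inter> space (M s)))
        = (\<integral>\<omega>. g (fst (V s \<omega>)) * indicator C (V s \<omega>) \<partial>M s)"
      unfolding E_def g_def
      by (subst selected_joint_law[OF prob Xm rule_range rule_measurable W_law W_indep
            W_indep_BO[folded V_def] Z H2_Z_law C])
        (intro Bochner_Integration.integral_cong refl, auto simp: X V_def indicator_def)
    also have "\<dots> = (\<integral>v. g (fst v) * indicator C v \<partial>distr (M s) borel (V s))"
      using C by (subst integral_distr) auto
    finally show ?thesis unfolding law[of s] .
  qed
  have pos': "0 < measure (M s) (E s)" if "s = t \<or> s = t'" for s
    using that pos by (auto simp: E_def)
  have "distr (uniform_measure (M t) (E t)) borel (V t)
      = distr (uniform_measure (M t') (E t')) borel (V t')"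
  proof (rule measure_eqI)
    fix C :: "((real^'m) \<times> (real^'n)) set" assume "C \<in> sets (distr (uniform_measure (M t) (E t)) borel (V t))"
    then have C: "C \<in> sets borel" by simp
    \<comment> \<open>The denominator is the probability of \<open>E s\<close>, obtained from
      \<open>joint\<close> with the whole space as \<open>C\<close>. Numerator and denominator
      therefore agree in both rounds.\<close>
    have em: "emeasure (distr (uniform_measure (M s) (E s)) borel (V s)) C
      = ennreal (\<integral>v. g (fst v) * indicator C v \<partial>distr (M t) borel (V t))
        / ennreal (\<integral>v. g (fst v) * indicator UNIV v \<partial>distr (M t) borel (V t))"
      if s: "s = t \<or> s = t'" for s
    proof -
      interpret prob_space "M s" by (rule prob)
      have [measurable]: "V s -` C \<inter> space (M s) \<in> sets (M s)" using C by (intro measurable_sets[OF Vm])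
      have "E s \<inter> (V s -` UNIV \<inter> space (M s)) = E s" using sets.sets_into_space[OF Em] by auto
      then show ?thesis
        using C joint[OF s C] joint[OF s, of UNIV]
        by (simp add: emeasure_distr emeasure_eq_measure)
    qed
    show "emeasure (distr (uniform_measure (M t) (E t)) borel (V t)) C
      = emeasure (distr (uniform_measure (M t') (E t')) borel (V t')) C"
      using em[of t] em[of t'] by simp
  qed simp
  \<comment> \<open>The noise of decision maker \<open>i\<close> is a coordinate of
    \<open>V s\<close>, so its conditional mean depends only on the conditional law just
    compared.\<close>
  moreover have "event_expectation (M s) (E s) (O\<^sub>n s i)
      = (\<integral>v. snd v $ i \<partial>distr (uniform_measure (M s) (E s)) borel (V s))" for s
  proof -
    have "(\<lambda>v. snd v $ i) \<in> borel_measurable (borel :: ((real^'m) \<times> (real^'n)) measure)"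
      by (intro borel_measurable_continuous_onI continuous_intros)
    then show ?thesis
      unfolding event_expectation_def by (subst integral_distr) (auto simp: V_def)
  qed
  ultimately have noise: "event_expectation (M t) (E t) (O\<^sub>n t i)
      = event_expectation (M t') (E t') (O\<^sub>n t' i)" by simp
  \<comment> \<open>Linearity of the conditional expectation. Splitting the integral requires both
    parts to be integrable under the conditioned measure, which follows from the positive
    probability of \<open>E s\<close>; the covariates are integrable as a constant shift of the
    baseline.\<close>
  have outcome: "event_expectation (M s) (E s) (Y s i)
      = event_expectation (M s) (E s) (X s) \<bullet> \<theta>star i + event_expectation (M s) (E s) (O\<^sub>n s i)"
    if s: "s = t \<or> s = t'" for s
  proof -
    interpret prob_space "M s" by (rule prob)
    have "integrable (M s) (X s)"
      using B_integrable[of s] X by (subst Bochner_Integration.integrable_cong[OF refl X]) auto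
    then have "integrable (uniform_measure (M s) (E s)) (X s)"
      "integrable (uniform_measure (M s) (E s)) (O\<^sub>n s i)"
      using O_integrable pos'[OF s] by (auto intro: integrable_uniform_measure)
    moreover have "(\<integral>\<omega>. Y s i \<omega> \<partial>uniform_measure (M s) (E s))
        = (\<integral>\<omega>. X s \<omega> \<bullet> \<theta>star i + O\<^sub>n s i \<omega> \<partial>uniform_measure (M s) (E s))"
      by (intro Bochner_Integration.integral_cong refl) (simp add: Y_eq)
    ultimately show ?thesis unfolding event_expectation_def by simp
  qed
  show ?thesis
    using outcome[of t] outcome[of t'] noise unfolding E_def by (simp add: inner_diff_left)
qed

end
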